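(* Let $f:\mathcal L\to\mathcal L$ be a smooth diffeomorphism which is symplectic with respect to the Kähler form $\frac{d\xi\wedge d\eta}{4\xi^2}$ of $\mathcal L$, and let $J_f=|f_\zeta|^2-|f_{\overline\zeta}|^2$ be its Jacobian determinant. Let $\psi:\mathcal L\to\mathbb R$ be a function satisfying $$\psi_\zeta=\frac{i}{4\,\Re(\zeta)}+\frac{(\Im f)_\zeta}{2\,\Re(f)}\quad\text{on }\mathcal L.$$ Then the map $F=(f_I,f_3):\mathfrak H^\star\to\mathfrak H^\star$ given by $$f_I(z,t)=z\,J_f^{1/4}(-|z|^2+it)\,e^{i\psi(-|z|^2+it)},\qquad f_3(z,t)=\Im\big(f(-|z|^2+it)\big),$$ is an orientation-preserving, circles-preserving contact transformation of $\mathfrak H^\star$. If moreover $f$ is quasiconformal with Beltrami coefficient $\mu_f=f_{\overline\zeta}/f_\zeta$, then $F$ is quasiconformal and $$\mu_F(z,t)=\mu_f(-|z|^2+it)\quad\text{for all }(z,t)\in\mathfrak H^\star.$$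
   Context: $\mathcal L=\{\zeta=\xi+i\eta\in\mathbb C: \xi<0\}$ is the left half-plane with hyperbolic metric $\frac{|d\zeta|^2}{4\Re^2(\zeta)}$; subscripts $\zeta,\overline\zeta$ denote Wirtinger derivatives. That $f=u+iv$ is symplectic means $f^*\big(\frac{d\xi\wedge d\eta}{4\xi^2}\big)=\frac{d\xi\wedge d\eta}{4\xi^2}$, i.e. $(\Re f(\zeta))^2=(\Re\zeta)^2J_f(\zeta)$. (A function $\psi$ as required exists for every such $f$, and is unique up to an additive constant.) The smooth map $f$ is quasiconformal if $\sup|\mu_f|<1$. The hyperbolic Heisenberg group $\mathfrak H^\star$ is $\mathbb C_*\times\mathbb R$, $\mathbb C_*=\mathbb C\setminus\{0\}$, with product $(z,t)\star(w,s)=(zw,t+s|z|^2)$. Its contact form is $\omega^\star=\frac{dt+2\Im(\overline z\,dz)}{2|z|^2}$. Put $\mathbf Z=z\frac{\partial}{\partial z}+i|z|^2\frac{\partial}{\partial t}$ and $\overline{\mathbf Z}=\overline z\frac{\partial}{\partial\overline z}-i|z|^2\frac{\partial}{\partial t}$. "Smooth" means at least of class $\mathcal C^2$. An orientation-preserving contact transformation of $\mathfrak H^\star$ is a smooth orientation-preserving diffeomorphism $F=(f_I,f_3)$ of $\mathfrak H^\star$ ($f_I$ complex-valued, $f_3$ real-valued) with $F^*\omega^\star=\lambda^\star\omega^\star$ for some positive function $\lambda^\star$. Such an $F$ is called $K$-quasiconformal if $$K_F=\frac{|\mathbf Zf_I|+|\overline{\mathbf Z}f_I|}{|\mathbf Zf_I|-|\overline{\mathbf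 Z}f_I|}\le K$$ everywhere on $\mathfrak H^\star$, and quasiconformal if this holds for some finite $K$; its Beltrami coefficient is $\mu_F=\overline{\mathbf Z}f_I/\mathbf Zf_I$. The Korányi map is $\alpha:\mathfrak H^\star\to\mathcal L$, $\alpha(z,t)=-|z|^2+it$. A bijection $F:\mathfrak H^\star\to\mathfrak H^\star$ is circles-preserving if for every $\zeta\in\mathcal L$ there is $\eta\in\mathcal L$ with $F(\alpha^{-1}(\zeta))=\alpha^{-1}(\eta)$. *)

theory Defs
  imports "HOL-Analysis.Analysis"
begin

text \<open>Maps between domains are total functions on the ambient vector space; only their behaviour on
  the (open) domain matters.  All derivatives are real Frechet derivatives, taken at interior points.\<close>

section \<open>Smoothness\<close>

text \<open>Class \<open>C\<^sup>k\<close> on an open set.\<close>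

primrec Ck_on ::
  "nat \<Rightarrow> ('a::real_normed_vector \<Rightarrow> 'b::real_normed_vector) \<Rightarrow> 'a set \<Rightarrow> bool" where
  "Ck_on 0 f S \<longleftrightarrow> continuous_on S f"
| "Ck_on (Suc k) f S \<longleftrightarrow>
     (\<forall>x\<in>S. f differentiable (at x)) \<and> (\<forall>v. Ck_on k (\<lambda>x. frechet_derivative f (at x) v) S)"

text \<open>Throughout, \<open>smooth\<close> means of class \<open>C\<^sup>2\<close>.\<close>

definition smooth_diffeo ::
  "'a::real_normed_vector set \<Rightarrow> 'b::real_normed_vector set \<Rightarrow> ('a \<Rightarrow> 'b) \<Rightarrow> bool" where
  "smooth_diffeo S T f \<longleftrightarrow> bij_betw f S T \<and> Ck_on 2 f S \<and> Ck_on 2 (inv_into S f) T"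

section \<open>The left half-plane\<close>

definition left_half_plane :: "complex set" where
  "left_half_plane = {\<zeta>. Re \<zeta> < 0}"

definition wirtinger :: "(complex \<Rightarrow> complex) \<Rightarrow> complex \<Rightarrow> complex" where
  "wirtinger f \<zeta> =
     (frechet_derivative f (at \<zeta>) 1 - \<i> * frechet_derivative f (at \<zeta>) \<i>) / 2"

definition wirtinger_bar :: "(complex \<Rightarrow> complex) \<Rightarrow> complex \<Rightarrow> complex" where
  "wirtinger_bar f \<zeta> =
     (frechet_derivative f (at \<zeta>) 1 + \<i> * frechet_derivative f (at \<zeta>) \<i>) / 2"

definition jacobian :: "(complex \<Rightarrow> complex) \<Rightarrow> complex \<Rightarrow> real" where
  "jacobian f \<zeta> = (cmod (wirtinger f \<zeta>))\<^sup>2 - (cmod (wirtinger_bar f \<zeta>))\<^sup>2"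

definition beltrami :: "(complex \<Rightarrow> complex) \<Rightarrow> complex \<Rightarrow> complex" where
  "beltrami f \<zeta> = wirtinger_bar f \<zeta> / wirtinger f \<zeta>"

text \<open>The 2-form \<open>d\<xi> \<and> d\<eta> / (4 \<xi>\<^sup>2)\<close> at \<open>\<zeta> = \<xi> + i\<eta>\<close>, evaluated on the tangent vectors \<open>v\<close>, \<open>w\<close>.\<close>

definition kaehler_form :: "complex \<Rightarrow> complex \<Rightarrow> complex \<Rightarrow> real" where
  "kaehler_form \<zeta> v w = (Re v * Im w - Im v * Re w) / (4 * (Re \<zeta>)\<^sup>2)"

text \<open>Pullback invariance of \<^const>\<open>kaehler_form\<close>.\<close>

definition symplectic :: "(complex \<Rightarrow> complex) \<Rightarrow> bool" where
  "symplectic f \<longleftrightarrow> (\<forall>\<zeta>\<in>left_half_plane. \<forall>v w.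
     kaehler_form (f \<zeta>) (frechet_derivative f (at \<zeta>) v) (frechet_derivative f (at \<zeta>) w)
       = kaehler_form \<zeta> v w)"

text \<open>For use with smooth maps with nonvanishing \<^const>\<open>wirtinger\<close> derivative, such as symplectic
  ones.  The boundedness clause is needed because \<open>SUP\<close> over an unbounded set of reals is
  unspecified.\<close>

definition quasiconformal_plane :: "(complex \<Rightarrow> complex) \<Rightarrow> bool" where
  "quasiconformal_plane f \<longleftrightarrow>
     bdd_above ((\<lambda>\<zeta>. cmod (beltrami f \<zeta>)) ` left_half_plane) \<and>
     (SUP \<zeta>\<in>left_half_plane. cmod (beltrami f \<zeta>)) < 1"

section \<open>The hyperbolic Heisenberg group\<close>

text \<open>The underlying set of the group; the group law itself plays no role below.\<close>

definition heis :: "(complex \<times> real) set" where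
  "heis = (UNIV - {0}) \<times> UNIV"

text \<open>The form \<open>(dt + 2 Im (cnj z dz)) / (2 |z|\<^sup>2)\<close> at \<open>(z, t)\<close>, evaluated on the tangent vector
  \<open>(w, s)\<close>.\<close>

definition contact_form :: "complex \<times> real \<Rightarrow> complex \<times> real \<Rightarrow> real" where
  "contact_form = (\<lambda>(z, t) (w, s). (s + 2 * Im (cnj z * w)) / (2 * (cmod z)\<^sup>2))"

definition to_coords :: "complex \<times> real \<Rightarrow> real ^ 3" where
  "to_coords = (\<lambda>(z, t). vector [Re z, Im z, t])"

definition of_coords :: "real ^ 3 \<Rightarrow> complex \<times> real" where
  "of_coords x = (Complex (x $ 1) (x $ 2), x $ 3)"

definition orientation_preserving :: "(complex \<times> real \<Rightarrow> complex \<times> real) \<Rightarrow> bool" where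
  "orientation_preserving F \<longleftrightarrow>
     (\<forall>p\<in>heis. det (matrix (to_coords \<circ> frechet_derivative F (at p) \<circ> of_coords)) > 0)"

definition op_contact_transformation :: "(complex \<times> real \<Rightarrow> complex \<times> real) \<Rightarrow> bool" where
  "op_contact_transformation F \<longleftrightarrow>
     smooth_diffeo heis heis F \<and> orientation_preserving F \<and>
     (\<exists>l :: complex \<times> real \<Rightarrow> real. \<forall>p\<in>heis. l p > 0 \<and>
        (\<forall>v. contact_form (F p) (frechet_derivative F (at p) v) = l p * contact_form p v))"

definition partial_z :: "(complex \<times> real \<Rightarrow> complex) \<Rightarrow> complex \<times> real \<Rightarrow> complex" where
  "partial_z g p =
     (frechet_derivative g (at p) (1, 0) - \<i> * frechet_derivative g (at p) (\<i>, 0)) / 2"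

definition partial_zbar :: "(complex \<times> real \<Rightarrow> complex) \<Rightarrow> complex \<times> real \<Rightarrow> complex" where
  "partial_zbar g p =
     (frechet_derivative g (at p) (1, 0) + \<i> * frechet_derivative g (at p) (\<i>, 0)) / 2"

definition partial_t :: "(complex \<times> real \<Rightarrow> complex) \<Rightarrow> complex \<times> real \<Rightarrow> complex" where
  "partial_t g p = frechet_derivative g (at p) (0, 1)"

definition Z_op :: "(complex \<times> real \<Rightarrow> complex) \<Rightarrow> complex \<times> real \<Rightarrow> complex" where
  "Z_op g = (\<lambda>(z, t).
     z * partial_z g (z, t) + \<i> * of_real ((cmod z)\<^sup>2) * partial_t g (z, t))"

definition Zbar_op :: "(complex \<times> real \<Rightarrow> complex) \<Rightarrow> complex \<times> real \<Rightarrow> complex" where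
  "Zbar_op g = (\<lambda>(z, t).
     cnj z * partial_zbar g (z, t) - \<i> * of_real ((cmod z)\<^sup>2) * partial_t g (z, t))"

definition distortion :: "(complex \<times> real \<Rightarrow> complex \<times> real) \<Rightarrow> complex \<times> real \<Rightarrow> real" where
  "distortion F p =
     (cmod (Z_op (fst \<circ> F) p) + cmod (Zbar_op (fst \<circ> F) p)) /
     (cmod (Z_op (fst \<circ> F) p) - cmod (Zbar_op (fst \<circ> F) p))"

definition heis_beltrami ::
  "(complex \<times> real \<Rightarrow> complex \<times> real) \<Rightarrow> complex \<times> real \<Rightarrow> complex" where
  "heis_beltrami F p = Zbar_op (fst \<circ> F) p / Z_op (fst \<circ> F) p"

text \<open>The strict inequality makes the denominator of \<^const>\<open>distortion\<close> positive; otherwise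
  \<open>x / 0 = 0\<close> or a negative quotient would satisfy the bound vacuously.\<close>

definition K_quasiconformal :: "real \<Rightarrow> (complex \<times> real \<Rightarrow> complex \<times> real) \<Rightarrow> bool" where
  "K_quasiconformal K F \<longleftrightarrow> op_contact_transformation F \<and>
     (\<forall>p\<in>heis. cmod (Zbar_op (fst \<circ> F) p) < cmod (Z_op (fst \<circ> F) p) \<and> distortion F p \<le> K)"

definition quasiconformal_heis :: "(complex \<times> real \<Rightarrow> complex \<times> real) \<Rightarrow> bool" where
  "quasiconformal_heis F \<longleftrightarrow> (\<exists>K. K_quasiconformal K F)"

section \<open>The Koranyi map\<close>

definition koranyi :: "complex \<times> real \<Rightarrow> complex" where
  "koranyi = (\<lambda>(z, t). - of_real ((cmod z)\<^sup>2) + \<i> * of_real t)"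

definition koranyi_fibre :: "complex \<Rightarrow> (complex \<times> real) set" where
  "koranyi_fibre \<zeta> = {p \<in> heis. koranyi p = \<zeta>}"

definition circles_preserving :: "(complex \<times> real \<Rightarrow> complex \<times> real) \<Rightarrow> bool" where
  "circles_preserving F \<longleftrightarrow> bij_betw F heis heis \<and>
     (\<forall>\<zeta>\<in>left_half_plane. \<exists>\<eta>\<in>left_half_plane. F ` koranyi_fibre \<zeta> = koranyi_fibre \<eta>)"

definition circle_lift ::
  "(complex \<Rightarrow> complex) \<Rightarrow> (complex \<Rightarrow> real) \<Rightarrow> complex \<times> real \<Rightarrow> complex \<times> real" where
  "circle_lift f \<psi> = (\<lambda>(z, t).
     (z * of_real (jacobian f (koranyi (z, t)) powr (1/4))
        * exp (\<i> * of_real (\<psi> (koranyi (z, t)))),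
      Im (f (koranyi (z, t)))))"

end

theory Submission
  imports Defs
begin

text \<open>Write \<open>\<alpha>\<close> for the Koranyi map, \<open>f = u + iv\<close>, \<open>\<zeta> = \<xi> + i\<eta>\<close>.  Since \<open>f\<close> is symplectic,
  \<open>J\<^sub>f = (u / \<xi>)\<^sup>2\<close>, so the first component of the lift is \<open>z exp (\<Phi> \<circ> \<alpha>)\<close> with
  \<open>\<Phi> = ln (u / \<xi>) / 2 + i\<psi>\<close>.  The hypothesis on \<open>\<psi>\<close> says \<open>d\<psi> = dv / (2u) - d\<eta> / (2\<xi>)\<close>, hence
  \<open>d\<Phi> = df / (2u) - d\<zeta> / (2\<xi>)\<close>: this makes \<open>\<Phi>\<close> of class \<open>C\<^sup>2\<close>, shows that the lift \<open>F\<close> preserves the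
  contact form itself (\<open>\<lambda> = 1\<close>), and gives \<open>Z f\<^sub>I = f\<^sub>I (\<xi> / u) f\<^sub>\<zeta>\<close> together with its conjugate
  analogue.  Moreover \<open>\<alpha> \<circ> F = f \<circ> \<alpha>\<close>, so that fibres go to fibres, the inverse of \<open>F\<close> is
  \<open>(z, t) \<mapsto> (z exp (- \<Phi> \<circ> f\<^sup>-\<^sup>1 \<circ> \<alpha>), Im (f\<^sup>-\<^sup>1 \<circ> \<alpha>))\<close>, and the determinant of \<open>DF\<close> is \<open>J\<^sub>f \<circ> \<alpha>\<close>.\<close>

section \<open>Calculus of \<open>C\<^sup>k\<close> maps\<close>

lemma Ck_on_SucD:
  assumes "Ck_on (Suc k) f S"
  shows "x \<in> S \<Longrightarrow> (f has_derivative frechet_derivative f (at x)) (at x)"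
    and "Ck_on k (\<lambda>x. frechet_derivative f (at x) v) S"
  using assms by (auto simp: frechet_derivative_works)

lemma has_derivative_frechetI:
  "(f has_derivative f') (at x) \<Longrightarrow> (f has_derivative frechet_derivative f (at x)) (at x)"
  by (metis frechet_derivative_at)

text \<open>Openness of \<open>S\<close> makes derivatives at its points depend only on values on
  \<open>S\<close>, so formulas valid only on the domain may be substituted at every order.\<close>

lemma Ck_on_cong:
  assumes "open S" "\<And>x. x \<in> S \<Longrightarrow> f x = g x" "Ck_on k f S"
  shows "Ck_on k g S"
  using assms(2,3)
proof (induction k arbitrary: f g)
  case 0
  then show ?case by (simp cong: continuous_on_cong)
next
  case (Suc k)
  have der: "(g has_derivative frechet_derivative f (at x)) (at x)" if "x \<in> S" for x
    using Ck_on_SucD(1)[OF Suc.prems(2) that] assms(1) that Suc.prems(1)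
    by (rule has_derivative_transform_within_open)
  have "Ck_on k (\<lambda>x. frechet_derivative g (at x) v) S" for v
    by (rule Suc.IH[OF _ Ck_on_SucD(2)[OF Suc.prems(2)]])
      (simp add: frechet_derivative_at[OF der, symmetric])
  then show ?case
    using der by (auto simp: differentiable_def)
qed

lemma Ck_on_SucI:
  assumes "open S" "\<And>x. x \<in> S \<Longrightarrow> (f has_derivative f' x) (at x)" "\<And>v. Ck_on k (\<lambda>x. f' x v) S"
  shows "Ck_on (Suc k) f S"
proof -
  have "Ck_on k (\<lambda>x. frechet_derivative f (at x) v) S" for v
    by (rule Ck_on_cong[OF assms(1) _ assms(3)])
      (simp add: frechet_derivative_at[OF assms(2), symmetric])
  then show ?thesis
    using assms(2) by (auto simp: differentiable_def)
qed

lemma Ck_on_Suc_imp_Ck_on: "Ck_on (Suc k) f S \<Longrightarrow> Ck_on k f S"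
proof (induction k arbitrary: f)
  case 0
  then show ?case
    by (auto intro!: continuous_at_imp_continuous_on differentiable_imp_continuous_within)
next
  case (Suc k)
  show ?case
    using Suc.prems Suc.IH[OF Ck_on_SucD(2)[OF Suc.prems]] by simp
qed

lemma Ck_on_const: "open S \<Longrightarrow> Ck_on k (\<lambda>x. c) S"
proof (induction k arbitrary: c)
  case (Suc k)
  show ?case
    by (rule Ck_on_SucI[OF Suc.prems has_derivative_const Suc.IH[OF Suc.prems]])
qed simp

lemma Ck_on_linear:
  assumes "open S" "bounded_linear h" "Ck_on k f S"
  shows "Ck_on k (\<lambda>x. h (f x)) S"
  using assms(3)
proof (induction k arbitrary: f)
  case 0
  then show ?case by (simp add: bounded_linear.continuous_on[OF assms(2)])
next
  case (Suc k)
  show ?case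
    by (rule Ck_on_SucI[OF assms(1)])
      (rule bounded_linear.has_derivative[OF assms(2)] Ck_on_SucD[OF Suc.prems] Suc.IH | assumption)+
qed

lemma Ck_on_ident: "open S \<Longrightarrow> Ck_on k (\<lambda>x. x) S"
  by (cases k) (auto intro!: Ck_on_SucI[where f' = "\<lambda>_ v. v"] Ck_on_const simp del: Ck_on.simps(2))

lemma Ck_on_add:
  assumes "open S" "Ck_on k f S" "Ck_on k g S"
  shows "Ck_on k (\<lambda>x. f x + g x) S"
  using assms(2,3)
proof (induction k arbitrary: f g)
  case 0
  then show ?case by (simp add: continuous_on_add)
next
  case (Suc k)
  show ?case
    by (rule Ck_on_SucI[OF assms(1)])
      (rule has_derivative_add Ck_on_SucD[OF Suc.prems(1)] Ck_on_SucD[OF Suc.prems(2)] Suc.IH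
        | assumption)+
qed

lemma Ck_on_minus: "open S \<Longrightarrow> Ck_on k f S \<Longrightarrow> Ck_on k (\<lambda>x. - f x) S"
  by (rule Ck_on_linear[OF _ bounded_linear_minus[OF bounded_linear_ident]])

lemma Ck_on_diff:
  "open S \<Longrightarrow> Ck_on k f S \<Longrightarrow> Ck_on k g S \<Longrightarrow> Ck_on k (\<lambda>x. f x - g x) S"
  using Ck_on_add[of S k f "\<lambda>x. - g x"] Ck_on_minus[of S k g] by simp

lemma Ck_on_sum:
  assumes "open S" "finite I" "\<And>i. i \<in> I \<Longrightarrow> Ck_on k (f i) S"
  shows "Ck_on k (\<lambda>x. \<Sum>i\<in>I. f i x) S"
  using assms(2,3) by (induction I) (auto intro: Ck_on_const Ck_on_add assms(1))

text \<open>One product rule for multiplication, scaling and inner products: in each term of the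
  derivative one factor is differentiated and the other is merely lowered by one order.\<close>

lemma Ck_on_bilinear:
  assumes "open S" "bounded_bilinear h" "Ck_on k f S" "Ck_on k g S"
  shows "Ck_on k (\<lambda>x. h (f x) (g x)) S"
  using assms(3,4)
proof (induction k arbitrary: f g)
  case 0
  then show ?case by (simp add: bounded_bilinear.continuous_on[OF assms(2)])
next
  case (Suc k)
  show ?case
    by (rule Ck_on_SucI[OF assms(1)])
      (rule bounded_bilinear.FDERIV[OF assms(2)] Ck_on_add assms(1) Suc.IH
        Ck_on_Suc_imp_Ck_on[OF Suc.prems(1)] Ck_on_Suc_imp_Ck_on[OF Suc.prems(2)]
        Ck_on_SucD[OF Suc.prems(1)] Ck_on_SucD[OF Suc.prems(2)] | assumption)+
qed

lemmas Ck_on_mult = Ck_on_bilinear[OF _ bounded_bilinear_mult]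
lemmas Ck_on_scaleR = Ck_on_bilinear[OF _ bounded_bilinear_scaleR]
lemmas Ck_on_inner = Ck_on_bilinear[OF _ bounded_bilinear_inner]

text \<open>Bootstrapping: the derivative contains \<open>inverse (f x)\<close> again, but one order
  less of it suffices, which the induction hypothesis supplies for the same
  \<open>f\<close>.\<close>

lemma Ck_on_inverse:
  fixes f :: "'a::real_normed_vector \<Rightarrow> 'b::real_normed_field"
  assumes "open S" "\<And>x. x \<in> S \<Longrightarrow> f x \<noteq> 0" "Ck_on k f S"
  shows "Ck_on k (\<lambda>x. inverse (f x)) S"
  using assms(3)
proof (induction k)
  case 0
  then show ?case using assms(2) by (auto intro!: continuous_on_inverse)
next
  case (Suc k)
  show ?case
  proof (rule Ck_on_SucI[OF assms(1)])
    show "((\<lambda>x. inverse (f x)) has_derivative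
        (\<lambda>v. - (inverse (f x) * frechet_derivative f (at x) v * inverse (f x)))) (at x)"
      if "x \<in> S" for x
      by (rule Deriv.has_derivative_inverse[OF assms(2)[OF that] Ck_on_SucD(1)[OF Suc.prems that]])
    show "Ck_on k (\<lambda>x. - (inverse (f x) * frechet_derivative f (at x) v * inverse (f x))) S" for v
      by (intro Ck_on_minus Ck_on_mult assms(1) Suc.IH Ck_on_SucD(2)[OF Suc.prems]
          Ck_on_Suc_imp_Ck_on[OF Suc.prems])
  qed
qed

lemma Ck_on_exp:
  fixes f :: "'a::real_normed_vector \<Rightarrow> 'b::{banach, real_normed_field}"
  assumes "open S" "Ck_on k f S"
  shows "Ck_on k (\<lambda>x. exp (f x)) S"
  using assms(2)
proof (induction k)
  case 0
  then show ?case by (auto intro!: continuous_on_exp)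
next
  case (Suc k)
  show ?case
  proof (rule Ck_on_SucI[OF assms(1)])
    show "((\<lambda>x. exp (f x)) has_derivative
        (\<lambda>v. exp (f x) * frechet_derivative f (at x) v)) (at x)"
      if "x \<in> S" for x
      using has_derivative_compose[OF Ck_on_SucD(1)[OF Suc.prems that]
          DERIV_exp[of "f x", unfolded has_field_derivative_def]] by simp
    show "Ck_on k (\<lambda>x. exp (f x) * frechet_derivative f (at x) v) S" for v
      by (intro Ck_on_mult assms(1) Suc.IH Ck_on_SucD(2)[OF Suc.prems]
          Ck_on_Suc_imp_Ck_on[OF Suc.prems])
  qed
qed

text \<open>By the chain rule \<open>f\<close> is differentiated in a direction that varies with
  \<open>x\<close>, while \<open>Ck_on\<close> controls fixed directions only. Expanding the
  direction in \<open>Basis\<close> gives a finite sum of products to which the induction hypothesis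
  applies; hence the Euclidean middle space.\<close>

lemma Ck_on_compose:
  fixes g :: "'a::real_normed_vector \<Rightarrow> 'b::euclidean_space"
  assumes "open S" "g ` S \<subseteq> T" "Ck_on k f T" "Ck_on k g S"
  shows "Ck_on k (\<lambda>x. f (g x)) S"
  using assms(3,4)
proof (induction k arbitrary: f)
  case 0
  then show ?case using assms(2) by (auto intro: continuous_on_compose2)
next
  case (Suc k)
  have der: "(f has_derivative frechet_derivative f (at (g x))) (at (g x))" if "x \<in> S" for x
    using Ck_on_SucD(1)[OF Suc.prems(1)] assms(2) that by blast
  show ?case
  proof (rule Ck_on_SucI[OF assms(1)])
    fix x assume x: "x \<in> S"
    have repr: "frechet_derivative f (at (g x)) w =
        (\<Sum>b\<in>Basis. (w \<bullet> b) *\<^sub>R frechet_derivative f (at (g x)) b)" for w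
    proof -
      interpret D: linear "frechet_derivative f (at (g x))"
        using der[OF x] by (rule has_derivative_linear)
      show ?thesis
        by (subst (1) euclidean_representation[of w, symmetric]) (simp add: D.sum D.scale)
    qed
    show "((\<lambda>x. f (g x)) has_derivative (\<lambda>v. \<Sum>b\<in>Basis.
        (frechet_derivative g (at x) v \<bullet> b) *\<^sub>R frechet_derivative f (at (g x)) b)) (at x)"
      by (rule has_derivative_eq_rhs[OF
            has_derivative_compose[OF Ck_on_SucD(1)[OF Suc.prems(2) x] der[OF x]]])
        (rule ext, rule repr)
  next
    show "Ck_on k (\<lambda>x. \<Sum>b\<in>Basis.
        (frechet_derivative g (at x) v \<bullet> b) *\<^sub>R frechet_derivative f (at (g x)) b) S" for v
      by (intro Ck_on_sum Ck_on_scaleR Ck_on_inner Ck_on_const Ck_on_SucD(2)[OF Suc.prems(2)]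
          Suc.IH Ck_on_SucD(2)[OF Suc.prems(1)] Ck_on_Suc_imp_Ck_on[OF Suc.prems(2)] assms(1)
          finite_Basis)
  qed
qed

lemma Ck_on_Pair:
  assumes "open S" "Ck_on k f S" "Ck_on k g S"
  shows "Ck_on k (\<lambda>x. (f x, g x)) S"
  using assms(2,3)
proof (induction k arbitrary: f g)
  case 0
  then show ?case by (simp add: continuous_on_Pair)
next
  case (Suc k)
  show ?case
    by (rule Ck_on_SucI[OF assms(1)])
      (rule has_derivative_Pair Ck_on_SucD[OF Suc.prems(1)] Ck_on_SucD[OF Suc.prems(2)] Suc.IH
        | assumption)+
qed

section \<open>The Koranyi map\<close>

lemma open_heis: "open heis"
  unfolding heis_def by (intro open_Times open_UNIV) auto

lemma mem_heis [simp]: "(z, t) \<in> heis \<longleftrightarrow> z \<noteq> 0"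
  by (simp add: heis_def)

lemma open_left_half_plane: "open left_half_plane"
  unfolding left_half_plane_def by (rule open_halfspace_Re_lt)

lemma Re_koranyi: "Re (koranyi (z, t)) = - (cmod z)\<^sup>2"
  and Im_koranyi: "Im (koranyi (z, t)) = t"
  by (simp_all add: koranyi_def)

lemma koranyi_in_left_half_plane: "p \<in> heis \<Longrightarrow> koranyi p \<in> left_half_plane"
  by (cases p) (simp add: left_half_plane_def Re_koranyi)

text \<open>The inner product is bilinear, so in this form the rules for derivatives and for
  \<open>Ck_on\<close> apply without differentiating a norm.\<close>

lemma koranyi_eq_inner: "koranyi p = - of_real (fst p \<bullet> fst p) + \<i> * of_real (snd p)"
  by (cases p) (simp add: koranyi_def power2_norm_eq_inner)

lemma has_derivative_koranyi:
  "(koranyi has_derivative (\<lambda>(w, s). Complex (- 2 * (z \<bullet> w)) s)) (at (z, t))"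
  unfolding koranyi_eq_inner[abs_def]
  by (rule has_derivative_eq_rhs, (rule derivative_intros)+)
     (auto simp: fun_eq_iff complex_eq_iff inner_commute)

lemma Ck_on_koranyi: "Ck_on k koranyi heis"
  unfolding koranyi_eq_inner[abs_def]
  by (intro Ck_on_add Ck_on_minus Ck_on_mult Ck_on_inner open_heis Ck_on_const
      Ck_on_linear[OF open_heis bounded_linear_of_real]
      Ck_on_linear[OF open_heis bounded_linear_fst] Ck_on_linear[OF open_heis bounded_linear_snd]
      Ck_on_ident)

section \<open>Determinants and Wirtinger derivatives\<close>

text \<open>Links the Wirtinger definition to the numerator of \<open>kaehler_form\<close>: both are
  the real determinant of the derivative.\<close>

lemma jacobian_eq:
  "jacobian f \<zeta> = Re (frechet_derivative f (at \<zeta>) 1) * Im (frechet_derivative f (at \<zeta>) \<i>)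
     - Im (frechet_derivative f (at \<zeta>) 1) * Re (frechet_derivative f (at \<zeta>) \<i>)"
  unfolding jacobian_def cmod_power2 wirtinger_def wirtinger_bar_def
  by (simp add: power2_eq_square field_simps)

text \<open>The derivative of the Koranyi map kills \<open>(\<i> z, 0)\<close> and sends \<open>(z, 0)\<close> and \<open>(0, 1)\<close> to
  multiples of \<open>1\<close> and \<open>\<i>\<close>.\<close>

lemma det_adapted_basis:
  fixes L :: "complex \<times> real \<Rightarrow> complex \<times> real"
  assumes "linear L" and "L (\<i> * z, 0) = (\<i> * w, 0)" "L (z, 0) = (a, s)" "L (0, 1) = (b, r)"
  shows "(cmod z)\<^sup>2 * det (matrix (to_coords \<circ> L \<circ> of_coords)) = (w \<bullet> a) * r - (w \<bullet> b) * s"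
proof -
  interpret L: linear L by fact
  obtain p p3 where p: "L (1, 0) = (p, p3)" by fastforce
  obtain q q3 where q: "L (\<i>, 0) = (q, q3)" by fastforce
  have L: "L (c, 0) = Re c *\<^sub>R (p, p3) + Im c *\<^sub>R (q, q3)" for c
  proof -
    have "(c, 0) = Re c *\<^sub>R (1, 0) + Im c *\<^sub>R (\<i>, 0 :: real)"
      by (simp add: complex_eq_iff)
    then show ?thesis using p q by (metis L.add L.scale)
  qed
  have of_coords_axis: "of_coords (axis 1 1) = (1, 0)" "of_coords (axis 2 1) = (\<i>, 0)"
    "of_coords (axis 3 1) = (0, 1)"
    by (simp_all add: of_coords_def axis_def complex_eq_iff)
  have det: "det (matrix (to_coords \<circ> L \<circ> of_coords)) =
      Re p * Im q * r + Re q * Im b * p3 + Re b * Im p * q3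
      - Re p * Im b * q3 - Re q * Im p * r - Re b * Im q * p3"
    by (simp add: det_3 matrix_def of_coords_axis p q assms to_coords_def)
  have w: "Im w = Im z * Re p - Re z * Re q" "Re w = - Im z * Im p + Re z * Im q"
      "0 = - Im z * p3 + Re z * q3"
    using assms(2) L[of "\<i> * z"] by (auto simp: complex_eq_iff)
  have a: "Re a = Re z * Re p + Im z * Re q" "Im a = Re z * Im p + Im z * Im q"
      "s = Re z * p3 + Im z * q3"
    using assms(3) L[of z] by (auto simp: complex_eq_iff)
  \<comment> \<open>The basis \<open>(z, 0)\<close>, \<open>(\<i> * z, 0)\<close>,
    \<open>(0, 1)\<close> has determinant |z|^2, and \<open>w \<bullet> a\<close> is the determinant
    of \<open>a\<close> and \<open>\<i> * w\<close>; the claim is expansion along third coordinates.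
    In the standard basis the two sides differ by a multiple of the third component of
    \<open>L (\<i> * z, 0)\<close>, which is zero.\<close>
  have "(cmod z)\<^sup>2 * det (matrix (to_coords \<circ> L \<circ> of_coords)) - ((w \<bullet> a) * r - (w \<bullet> b) * s)
      = (- Im z * p3 + Re z * q3) *
        (Re b * (Re z * Im p + Im z * Im q) - Im b * (Re z * Re p + Im z * Re q))"
    unfolding det cmod_power2 inner_complex_def w a by (simp add: algebra_simps power2_eq_square)
  then show ?thesis
    using w(3) by simp
qed

lemma inner_mult_self: "x \<bullet> (x * c) = (cmod x)\<^sup>2 * Re c" for x c :: complex
  unfolding cmod_power2 by (simp add: inner_complex_def power2_eq_square algebra_simps)

text \<open>For a real function one complex number carries both partial derivatives, so the
  hypothesis on \<open>\<psi>\<close> splits into two real equations.\<close>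

lemma wirtinger_of_real:
  assumes "(h has_derivative h') (at \<zeta>)"
  shows "wirtinger (\<lambda>x. of_real (h x)) \<zeta> = Complex (h' 1 / 2) (- h' \<i> / 2)"
proof -
  have "((\<lambda>x. complex_of_real (h x)) has_derivative (\<lambda>v. of_real (h' v))) (at \<zeta>)"
    by (rule has_derivative_of_real[OF assms])
  then show ?thesis
    unfolding wirtinger_def by (simp add: frechet_derivative_at[symmetric] complex_eq_iff)
qed

section \<open>Lifting a symplectic diffeomorphism\<close>

locale symplectic_lift =
  fixes f :: "complex \<Rightarrow> complex" and \<psi> :: "complex \<Rightarrow> real"
  assumes diffeo: "smooth_diffeo left_half_plane left_half_plane f"
    and sympl: "symplectic f"
    and psi_differentiable: "\<And>\<zeta>. \<zeta> \<in> left_half_plane \<Longrightarrow> \<psi> differentiable (at \<zeta>)"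
    and psi_wirtinger: "\<And>\<zeta>. \<zeta> \<in> left_half_plane \<Longrightarrow>
           wirtinger (\<lambda>x. of_real (\<psi> x)) \<zeta> =
             \<i> / (4 * of_real (Re \<zeta>)) +
             wirtinger (\<lambda>x. of_real (Im (f x))) \<zeta> / (2 * of_real (Re (f \<zeta>)))"
begin

abbreviation "D \<zeta> \<equiv> frechet_derivative f (at \<zeta>)"

abbreviation "g \<equiv> inv_into left_half_plane f"

text \<open>The \<Phi> of the overview, a logarithm of the factor multiplying z. Its real part is
  halved because the fourth root of (u/\<xi>)^2 is the square root of u/\<xi>.\<close>

definition log_factor :: "complex \<Rightarrow> complex" where
  "log_factor \<zeta> = of_real (ln (Re (f \<zeta>) / Re \<zeta>) / 2) + \<i> * of_real (\<psi> \<zeta>)"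

section \<open>The base diffeomorphism and its Jacobian\<close>

lemma bij: "bij_betw f left_half_plane left_half_plane"
  and Ck_f: "Ck_on 2 f left_half_plane"
  and Ck_g: "Ck_on 2 g left_half_plane"
  using diffeo by (auto simp: smooth_diffeo_def)

lemma f_in: "\<zeta> \<in> left_half_plane \<Longrightarrow> f \<zeta> \<in> left_half_plane"
  using bij bij_betwE by blast

lemma g_in: "\<zeta> \<in> left_half_plane \<Longrightarrow> g \<zeta> \<in> left_half_plane"
  using bij_betw_inv_into[OF bij] bij_betwE by blast

lemma f_g: "\<zeta> \<in> left_half_plane \<Longrightarrow> f (g \<zeta>) = \<zeta>"
  and g_f: "\<zeta> \<in> left_half_plane \<Longrightarrow> g (f \<zeta>) = \<zeta>"
  using bij_betw_inv_into_right[OF bij] bij_betw_inv_into_left[OF bij] by blast+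

lemma Re_neg: "\<zeta> \<in> left_half_plane \<Longrightarrow> Re \<zeta> < 0"
  and Re_f_neg: "\<zeta> \<in> left_half_plane \<Longrightarrow> Re (f \<zeta>) < 0"
  using f_in by (auto simp: left_half_plane_def)

lemma quotient_pos: "\<zeta> \<in> left_half_plane \<Longrightarrow> Re (f \<zeta>) / Re \<zeta> > 0"
  using Re_neg Re_f_neg by (simp add: divide_neg_neg)

lemma has_derivative_f: "\<zeta> \<in> left_half_plane \<Longrightarrow> (f has_derivative D \<zeta>) (at \<zeta>)"
  using Ck_on_SucD(1)[of 1 f] Ck_f by (simp add: numeral_2_eq_2)

lemma D_decomp:
  "\<zeta> \<in> left_half_plane \<Longrightarrow> D \<zeta> v = of_real (Re v) * D \<zeta> 1 + of_real (Im v) * D \<zeta> \<i>"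
proof -
  assume "\<zeta> \<in> left_half_plane"
  then interpret linear "D \<zeta>"
    by (rule has_derivative_linear[OF has_derivative_f])
  have "v = Re v *\<^sub>R 1 + Im v *\<^sub>R \<i>"
    by (simp add: complex_eq_iff)
  then show ?thesis
    by (metis add scale scaleR_conv_of_real)
qed

text \<open>Invariance of the area form on the frame \<open>1\<close>, \<open>\<i>\<close> reads
  J/(4u^2) = 1/(4\<xi>^2).\<close>

lemma jacobian_symplectic: "\<zeta> \<in> left_half_plane \<Longrightarrow> jacobian f \<zeta> = (Re (f \<zeta>) / Re \<zeta>)\<^sup>2"
proof -
  assume \<zeta>: "\<zeta> \<in> left_half_plane"
  then have "kaehler_form (f \<zeta>) (D \<zeta> 1) (D \<zeta> \<i>) = kaehler_form \<zeta> 1 \<i>"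
    using sympl by (simp add: symplectic_def)
  then show ?thesis
    using Re_neg[OF \<zeta>] Re_f_neg[OF \<zeta>]
    by (simp add: kaehler_form_def jacobian_eq field_simps)
qed

lemma jacobian_pos: "\<zeta> \<in> left_half_plane \<Longrightarrow> jacobian f \<zeta> > 0"
  by (metis jacobian_symplectic quotient_pos zero_less_power)

section \<open>The logarithmic factor and its regularity\<close>

lemma exp_log_factor:
  assumes "\<zeta> \<in> left_half_plane"
  shows "exp (log_factor \<zeta>) = of_real (jacobian f \<zeta> powr (1/4)) * exp (\<i> * of_real (\<psi> \<zeta>))"
proof -
  have "jacobian f \<zeta> powr (1/4) = exp (ln (Re (f \<zeta>) / Re \<zeta>) / 2)"
    using quotient_pos[OF assms] Re_neg[OF assms] Re_f_neg[OF assms]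
    by (simp add: jacobian_symplectic[OF assms] powr_def ln_realpow)
  then show ?thesis
    by (simp add: log_factor_def exp_add exp_of_real[symmetric] del: exp_of_real of_real_divide)
qed

text \<open>Multiplication by exp \<Phi> thus turns |z|^2 = -\<xi> into -u, which is what makes the
  lift cover \<open>f\<close>.\<close>

lemma exp_Re_log_factor:
  assumes "\<zeta> \<in> left_half_plane"
  shows "(exp (Re (log_factor \<zeta>)))\<^sup>2 = Re (f \<zeta>) / Re \<zeta>"
  using quotient_pos[OF assms] by (simp add: log_factor_def exp_double[symmetric])

lemma has_derivative_psi:
  assumes \<zeta>: "\<zeta> \<in> left_half_plane"
  shows "(\<psi> has_derivative (\<lambda>v. Im (D \<zeta> v) / (2 * Re (f \<zeta>)) - Im v / (2 * Re \<zeta>))) (at \<zeta>)"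
proof -
  obtain P where P: "(\<psi> has_derivative P) (at \<zeta>)"
    using psi_differentiable[OF \<zeta>] by (auto simp: differentiable_def)
  have Im_f: "((\<lambda>x. Im (f x)) has_derivative (\<lambda>v. Im (D \<zeta> v))) (at \<zeta>)"
    by (rule has_derivative_Im[OF has_derivative_f[OF \<zeta>]])
  have "Complex (P 1 / 2) (- P \<i> / 2) = \<i> / of_real (4 * Re \<zeta>) +
      Complex (Im (D \<zeta> 1) / 2) (- Im (D \<zeta> \<i>) / 2) / of_real (2 * Re (f \<zeta>))"
    using psi_wirtinger[OF \<zeta>] wirtinger_of_real[OF P] wirtinger_of_real[OF Im_f] by simp
  \<comment> \<open>Real parts give the partial along \<open>1\<close>, imaginary parts with
    reversed sign the one along \<open>\<i>\<close>. The term \<i>/(4\<xi>) is imaginary, so it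
    enters \<open>P \<i>\<close> only.\<close>
  then have P1: "P 1 = Im (D \<zeta> 1) / (2 * Re (f \<zeta>))"
    and Pi: "P \<i> = Im (D \<zeta> \<i>) / (2 * Re (f \<zeta>)) - 1 / (2 * Re \<zeta>)"
    using Re_neg[OF \<zeta>] Re_f_neg[OF \<zeta>]
    by (simp_all only: complex_eq_iff) (simp_all add: field_simps)
  interpret P: linear P
    using P by (rule has_derivative_linear)
  have P_decomp: "P v = Re v * P 1 + Im v * P \<i>" for v
  proof -
    have "v = Re v *\<^sub>R 1 + Im v *\<^sub>R \<i>"
      by (simp add: complex_eq_iff)
    then show ?thesis
      by (metis P.add P.scale real_scaleR_def)
  qed
  have "P = (\<lambda>v. Im (D \<zeta> v) / (2 * Re (f \<zeta>)) - Im v / (2 * Re \<zeta>))"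
    by (intro ext, subst P_decomp, subst D_decomp[OF \<zeta>])
      (simp add: P1 Pi diff_divide_distrib add_divide_distrib algebra_simps)
  then show ?thesis
    using P by simp
qed

text \<open>The differentials du/(2u) - d\<xi>/(2\<xi>) of the logarithm and dv/(2u) -
  d\<eta>/(2\<xi>) of \<open>\<psi>\<close> are the real and imaginary parts of a single complex
  form.\<close>

lemma has_derivative_log_factor:
  assumes \<zeta>: "\<zeta> \<in> left_half_plane"
  shows "(log_factor has_derivative
    (\<lambda>v. D \<zeta> v / of_real (2 * Re (f \<zeta>)) - v / of_real (2 * Re \<zeta>))) (at \<zeta>)"
proof -
  have "((\<lambda>\<zeta>. ln (Re (f \<zeta>) / Re \<zeta>)) has_derivative
      (\<lambda>v. Re (D \<zeta> v) / Re (f \<zeta>) - Re v / Re \<zeta>)) (at \<zeta>)"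
    using Re_neg[OF \<zeta>] Re_f_neg[OF \<zeta>]
    by (intro has_derivative_eq_rhs[OF has_derivative_ln[OF quotient_pos[OF \<zeta>]
          has_derivative_divide'[OF
            has_derivative_Re[OF has_derivative_f[OF \<zeta>]] has_derivative_Re[OF has_derivative_ident]
            less_imp_neq[OF Re_neg[OF \<zeta>]]]]]) (auto simp: fun_eq_iff field_simps)
  note ln_half = has_derivative_of_real[OF bounded_linear.has_derivative[OF bounded_linear_divide this]]
  show ?thesis
    unfolding log_factor_def[abs_def]
    by (rule has_derivative_eq_rhs[OF has_derivative_add[OF ln_half has_derivative_mult_right[OF
            has_derivative_of_real[OF has_derivative_psi[OF \<zeta>]]]]])
      (simp add: fun_eq_iff complex_eq_iff diff_divide_distrib Re_divide_of_real Im_divide_of_real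
        del: of_real_mult)
qed

text \<open>The derivative of \<Phi> involves \<open>f\<close> itself but no derivative of
  \<open>f\<close>, apart from the first one \<open>D \<zeta> v\<close>. It is therefore C^1,
  although \<open>\<psi>\<close> is only assumed differentiable.\<close>

lemma Ck_log_factor: "Ck_on 2 log_factor left_half_plane"
proof -
  have inv: "Ck_on 1 (\<lambda>\<zeta>. inverse (complex_of_real (2 * Re (h \<zeta>)))) left_half_plane"
    if "Ck_on 1 h left_half_plane" "\<And>\<zeta>. \<zeta> \<in> left_half_plane \<Longrightarrow> Re (h \<zeta>) < 0" for h
    using that(2)
    by (intro Ck_on_inverse Ck_on_linear[OF _ bounded_linear_of_real] Ck_on_mult
        Ck_on_linear[OF _ bounded_linear_Re] that(1) Ck_on_const open_left_half_plane) force
  have "Ck_on (Suc 1) log_factor left_half_plane"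
  proof (rule Ck_on_SucI[OF open_left_half_plane has_derivative_log_factor])
    have f: "Ck_on (Suc 1) f left_half_plane"
      using Ck_f by (simp only: numeral_2_eq_2 One_nat_def)
    show "Ck_on 1 (\<lambda>\<zeta>. D \<zeta> v / of_real (2 * Re (f \<zeta>)) - v / of_real (2 * Re \<zeta>))
        left_half_plane" for v
      unfolding divide_inverse
      by (intro Ck_on_diff Ck_on_mult open_left_half_plane Ck_on_SucD(2)[OF f] Ck_on_const inv
          Ck_on_Suc_imp_Ck_on[OF f] Ck_on_ident Re_neg Re_f_neg)
  qed
  then show ?thesis
    by (simp only: numeral_2_eq_2 One_nat_def)
qed

section \<open>The lift, its inverse and its fibres\<close>

abbreviation "F \<equiv> circle_lift f \<psi>"

text \<open>The inverse of \<open>F\<close>: the factor to be undone is the one at the source, whose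
  Koranyi image is \<open>g (koranyi p)\<close>.\<close>

definition G :: "complex \<times> real \<Rightarrow> complex \<times> real" where
  "G p = (fst p * exp (- log_factor (g (koranyi p))), Im (g (koranyi p)))"

lemma F_eq: "p \<in> heis \<Longrightarrow> F p = (fst p * exp (log_factor (koranyi p)), Im (f (koranyi p)))"
  using exp_log_factor[OF koranyi_in_left_half_plane]
  by (auto simp: circle_lift_def split: prod.splits)

lemma F_in: "p \<in> heis \<Longrightarrow> F p \<in> heis"
  and G_in: "p \<in> heis \<Longrightarrow> G p \<in> heis"
  by (auto simp: F_eq G_def heis_def)

lemma koranyi_F:
  assumes "p \<in> heis"
  shows "koranyi (F p) = f (koranyi p)"
proof -
  obtain z t where p: "p = (z, t)" and z: "z \<noteq> 0"
    using assms by (cases p) auto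
  have \<zeta>: "koranyi (z, t) \<in> left_half_plane"
    using koranyi_in_left_half_plane[OF assms] p by simp
  show ?thesis
    unfolding p using z
    by (intro complex_eqI)
      (simp_all add: F_eq Re_koranyi Im_koranyi norm_mult power_mult_distrib exp_Re_log_factor[OF \<zeta>])
qed

lemma koranyi_G:
  assumes "p \<in> heis"
  shows "koranyi (G p) = g (koranyi p)"
proof -
  obtain z t where p: "p = (z, t)" and z: "z \<noteq> 0"
    using assms by (cases p) auto
  have \<zeta>: "koranyi (z, t) \<in> left_half_plane"
    using koranyi_in_left_half_plane[OF assms] p by simp
  show ?thesis
    unfolding p using z Re_neg[OF g_in[OF \<zeta>]] exp_Re_log_factor[OF g_in[OF \<zeta>]]
    by (intro complex_eqI) (simp_all add: G_def Re_koranyi Im_koranyi norm_mult norm_divide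
        power_divide exp_minus f_g[OF \<zeta>] field_simps)
qed

lemma G_F:
  assumes "p \<in> heis"
  shows "G (F p) = p"
  unfolding G_def koranyi_F[OF assms] g_f[OF koranyi_in_left_half_plane[OF assms]]
  using assms by (cases p) (simp add: F_eq Im_koranyi exp_minus)

lemma F_G:
  assumes "p \<in> heis"
  shows "F (G p) = p"
  unfolding F_eq[OF G_in[OF assms]] koranyi_G[OF assms] f_g[OF koranyi_in_left_half_plane[OF assms]]
  by (cases p) (simp add: G_def Im_koranyi exp_minus)

lemma bij_F: "bij_betw F heis heis"
  by (rule bij_betw_byWitness[where f' = G]) (auto simp: G_F F_G F_in G_in)

lemma smooth_diffeo_F: "smooth_diffeo heis heis F"
proof -
  \<comment> \<open>\<open>F\<close> and \<open>G\<close> have this common shape: \<open>h\<close>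
    is \<Phi> and \<open>k\<close> is \<open>f\<close> for the former, \<open>h\<close> is -\<Phi>
    after \<open>g\<close> and \<open>k\<close> is \<open>g\<close> for the latter.\<close>
  have pairs: "Ck_on 2 (\<lambda>p. (fst p * exp (h (koranyi p)), Im (k (koranyi p)))) heis"
    if "Ck_on 2 h left_half_plane" "Ck_on 2 k left_half_plane"
    for h k :: "complex \<Rightarrow> complex"
    using koranyi_in_left_half_plane
    by (intro Ck_on_Pair Ck_on_mult Ck_on_exp Ck_on_linear[OF open_heis bounded_linear_Im]
        Ck_on_compose[OF open_heis _ that(1)] Ck_on_compose[OF open_heis _ that(2)]
        Ck_on_koranyi Ck_on_linear[OF open_heis bounded_linear_fst] Ck_on_ident open_heis) auto
  have "Ck_on 2 F heis"
    by (rule Ck_on_cong[OF open_heis _ pairs[OF Ck_log_factor Ck_f]]) (simp add: F_eq)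
  moreover have "Ck_on 2 (\<lambda>\<zeta>. - log_factor (g \<zeta>)) left_half_plane"
    using g_in by (intro Ck_on_minus Ck_on_compose[OF _ _ Ck_log_factor] Ck_g
        open_left_half_plane) auto
  from pairs[OF this Ck_g] have "Ck_on 2 (inv_into heis F) heis"
  proof (rule Ck_on_cong[OF open_heis, rotated])
    fix p assume "p \<in> heis"
    then show "(fst p * exp (- log_factor (g (koranyi p))), Im (g (koranyi p))) = inv_into heis F p"
      by (metis G_def F_G G_in bij_F bij_betw_imp_inj_on inv_into_f_f)
  qed
  ultimately show ?thesis
    using bij_F by (simp add: smooth_diffeo_def)
qed

lemma circles_preserving_F: "circles_preserving F"
  unfolding circles_preserving_def
proof (intro conjI ballI bexI)
  fix \<zeta> assume \<zeta>: "\<zeta> \<in> left_half_plane"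
  show "F ` koranyi_fibre \<zeta> = koranyi_fibre (f \<zeta>)"
  proof
    show "F ` koranyi_fibre \<zeta> \<subseteq> koranyi_fibre (f \<zeta>)"
      by (auto simp: koranyi_fibre_def koranyi_F F_in)
    show "koranyi_fibre (f \<zeta>) \<subseteq> F ` koranyi_fibre \<zeta>"
    proof
      fix q assume "q \<in> koranyi_fibre (f \<zeta>)"
      then show "q \<in> F ` koranyi_fibre \<zeta>"
        using \<zeta> by (intro image_eqI[of _ _ "G q"]) (auto simp: koranyi_fibre_def F_G G_in koranyi_G g_f)
    qed
  qed
qed (use bij_F f_in in auto)

section \<open>The derivative of the lift, contact form and orientation\<close>

lemma has_derivative_F:
  assumes "(z, t) \<in> heis" and \<zeta>: "\<zeta> = koranyi (z, t)"
  shows "(F has_derivative (\<lambda>(w, s). let v = Complex (- 2 * (z \<bullet> w)) s in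
      (exp (log_factor \<zeta>) *
         (w + z * (D \<zeta> v / of_real (2 * Re (f \<zeta>)) - v / of_real (2 * Re \<zeta>))),
       Im (D \<zeta> v)))) (at (z, t))"
proof (rule has_derivative_transform_within_open[OF _ open_heis assms(1)])
  have \<zeta>_in: "koranyi (z, t) \<in> left_half_plane"
    using assms(1) by (rule koranyi_in_left_half_plane)
  \<comment> \<open>Functions of \<open>koranyi\<close> are differentiated along \<open>v\<close>,
    the image of \<open>(w, s)\<close> under the derivative of the Koranyi map.\<close>
  note chain = has_derivative_compose[OF has_derivative_koranyi]
  show "((\<lambda>p. (fst p * exp (log_factor (koranyi p)), Im (f (koranyi p)))) has_derivative
      (\<lambda>(w, s). let v = Complex (- 2 * (z \<bullet> w)) s in
      (exp (log_factor \<zeta>) *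
         (w + z * (D \<zeta> v / of_real (2 * Re (f \<zeta>)) - v / of_real (2 * Re \<zeta>))),
       Im (D \<zeta> v)))) (at (z, t))"
    unfolding \<zeta>
    by (rule has_derivative_eq_rhs[OF has_derivative_Pair[OF has_derivative_mult[OF
            has_derivative_fst[OF has_derivative_ident]
            has_derivative_compose[OF chain[OF has_derivative_log_factor[OF \<zeta>_in]]
              DERIV_exp[unfolded has_field_derivative_def]]]
          has_derivative_Im[OF chain[OF has_derivative_f[OF \<zeta>_in]]]]])
      (auto simp: fun_eq_iff Let_def algebra_simps)
qed (simp add: F_eq)

lemma frechet_derivative_F:
  assumes "(z, t) \<in> heis" and "\<zeta> = koranyi (z, t)" and "v = Complex (- 2 * (z \<bullet> w)) s"
  shows "frechet_derivative F (at (z, t)) (w, s) =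
      (exp (log_factor \<zeta>) *
         (w + z * (D \<zeta> v / of_real (2 * Re (f \<zeta>)) - v / of_real (2 * Re \<zeta>))),
       Im (D \<zeta> v))"
  unfolding frechet_derivative_at[OF has_derivative_F[OF assms(1,2)], symmetric]
  by (simp add: assms(3) Let_def)

lemma frechet_derivative_fst_F:
  assumes "(z, t) \<in> heis"
  shows "frechet_derivative (fst \<circ> F) (at (z, t)) w = fst (frechet_derivative F (at (z, t)) w)"
proof -
  have "(F has_derivative frechet_derivative F (at (z, t))) (at (z, t))"
    using has_derivative_F[OF assms refl] by (rule has_derivative_frechetI)
  from has_derivative_fst[OF this] show ?thesis
    by (simp add: frechet_derivative_at[symmetric] comp_def)
qed

text \<open>The phase contributes -2u d\<psi> = -dv + (u/\<xi>) d\<eta> to the numerator. Its first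
  term cancels the dv of the third component; what remains is u/\<xi> times the old numerator, and
  the denominator grows by the same factor.\<close>

lemma contact_F:
  assumes "p \<in> heis"
  shows "contact_form (F p) (frechet_derivative F (at p) v) = contact_form p v"
proof -
  obtain z t w s where p: "p = (z, t)" and v: "v = (w, s)" by (cases p, cases v) auto
  define \<zeta> where "\<zeta> = koranyi (z, t)"
  define a where "a = Complex (- 2 * (z \<bullet> w)) s"
  define E where "E = exp (log_factor \<zeta>)"
  have \<zeta>: "\<zeta> \<in> left_half_plane"
    using koranyi_in_left_half_plane[OF assms] by (simp add: p \<zeta>_def)
  have z: "(cmod z)\<^sup>2 = - Re \<zeta>"
    by (simp add: \<zeta>_def Re_koranyi)
  have E: "(cmod E)\<^sup>2 = Re (f \<zeta>) / Re \<zeta>"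
    by (simp add: E_def exp_Re_log_factor[OF \<zeta>])
  have "cnj (z * E) * (E * (w + z * X)) =
      of_real ((cmod E)\<^sup>2) * (cnj z * w) + of_real ((cmod E)\<^sup>2 * (cmod z)\<^sup>2) * X" for X
    unfolding of_real_mult complex_norm_square by (simp add: algebra_simps)
  then have Im_X: "Im (cnj (z * E) * (E * (w + z * X))) =
      Re (f \<zeta>) / Re \<zeta> * Im (cnj z * w) - Re (f \<zeta>) * Im X" for X
    using Re_neg[OF \<zeta>] by (simp only: E z) simp
  have "Im (D \<zeta> a / of_real (2 * Re (f \<zeta>)) - a / of_real (2 * Re \<zeta>)) =
      Im (D \<zeta> a) / (2 * Re (f \<zeta>)) - s / (2 * Re \<zeta>)"
    unfolding minus_complex.sel Im_divide_of_real by (simp add: a_def)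
  moreover have "(cmod (z * E))\<^sup>2 = - Re (f \<zeta>)"
    using Re_neg[OF \<zeta>] by (simp add: norm_mult power_mult_distrib E z)
  moreover have "F p = (z * E, Im (f \<zeta>))"
    using F_eq[OF assms] by (simp add: p \<zeta>_def E_def)
  ultimately have "contact_form (F p) (frechet_derivative F (at p) v) =
      (Im (D \<zeta> a) + 2 * (Re (f \<zeta>) / Re \<zeta> * Im (cnj z * w) -
        Re (f \<zeta>) * (Im (D \<zeta> a) / (2 * Re (f \<zeta>)) - s / (2 * Re \<zeta>)))) / (2 * - Re (f \<zeta>))"
    unfolding p v frechet_derivative_F[OF assms[unfolded p] \<zeta>_def a_def] E_def[symmetric]
    by (simp only: contact_form_def prod.case Im_X)
  also have "\<dots> = (s + 2 * Im (cnj z * w)) / (2 * - Re \<zeta>)"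
    using Re_neg[OF \<zeta>] Re_f_neg[OF \<zeta>] by (simp add: divide_simps) (simp add: algebra_simps)
  finally show ?thesis
    by (simp only: p v contact_form_def prod.case z)
qed

lemma orientation_preserving_F: "orientation_preserving F"
  unfolding orientation_preserving_def
proof
  fix p assume p_in: "p \<in> heis"
  obtain z t where p: "p = (z, t)" by (cases p)
  define \<zeta> where "\<zeta> = koranyi (z, t)"
  define E where "E = exp (log_factor \<zeta>)"
  define U where "U = Re (f \<zeta>)"
  note der = frechet_derivative_F[OF p_in[unfolded p] \<zeta>_def refl, folded E_def U_def]
  have \<zeta>: "\<zeta> \<in> left_half_plane"
    using koranyi_in_left_half_plane[OF p_in] by (simp add: p \<zeta>_def)
  have z: "(cmod z)\<^sup>2 = - Re \<zeta>"
    by (simp add: \<zeta>_def Re_koranyi)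
  have neg: "Re \<zeta> < 0" "U < 0"
    using Re_neg[OF \<zeta>] Re_f_neg[OF \<zeta>] by (auto simp: U_def)
  have "(cmod E)\<^sup>2 * (cmod z)\<^sup>2 = - U"
    using neg by (simp add: E_def exp_Re_log_factor[OF \<zeta>] z U_def)
  then have inner: "(z * E) \<bullet> (z * E * c) = - U * Re c" for c
    using inner_mult_self[of "z * E" c] by (simp add: norm_mult power_mult_distrib mult.commute)
  let ?L = "frechet_derivative F (at p)"
  have "(F has_derivative ?L) (at p)"
    using has_derivative_F[OF p_in[unfolded p] refl] unfolding p by (rule has_derivative_frechetI)
  then have "linear ?L"
    by (rule has_derivative_linear)
  \<comment> \<open>The rotation direction is tangent to the fibres, so \<open>v\<close> is zero and
    only multiplication by \<open>E\<close> remains.\<close>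
  moreover have "?L (\<i> * z, 0) = (\<i> * (z * E), 0)"
  proof -
    have "Complex (- 2 * (z \<bullet> (\<i> * z))) 0 = 0"
      by (simp add: inner_complex_def complex_eq_iff)
    moreover have "D \<zeta> 0 = 0"
      by (subst D_decomp[OF \<zeta>]) simp
    ultimately show ?thesis
      unfolding p der by simp
  qed
  \<comment> \<open>Here \<open>v\<close> is 2\<xi>, and the term -v/(2\<xi>) cancels the 1 coming
    from the factor z.\<close>
  moreover have "?L (z, 0) = (z * E * (of_real (Re \<zeta> / U) * D \<zeta> 1), 2 * Re \<zeta> * Im (D \<zeta> 1))"
  proof -
    have "Complex (- 2 * (z \<bullet> z)) 0 = of_real (2 * Re \<zeta>)"
      by (simp add: complex_eq_iff z flip: power2_norm_eq_inner)
    moreover have "D \<zeta> (of_real (2 * Re \<zeta>)) = of_real (2 * Re \<zeta>) * D \<zeta> 1"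
      by (subst D_decomp[OF \<zeta>]) simp
    ultimately show ?thesis
      unfolding p der using neg by (simp add: field_simps)
  qed
  moreover have "?L (0, 1) =
      (z * E * (D \<zeta> \<i> / of_real (2 * U) - \<i> / of_real (2 * Re \<zeta>)), Im (D \<zeta> \<i>))"
    unfolding p der by (simp add: imaginary_unit.ctr[symmetric] algebra_simps)
  ultimately have "(cmod z)\<^sup>2 * det (matrix (to_coords \<circ> ?L \<circ> of_coords)) =
      - U * Re (of_real (Re \<zeta> / U) * D \<zeta> 1) * Im (D \<zeta> \<i>)
      - - U * Re (D \<zeta> \<i> / of_real (2 * U) - \<i> / of_real (2 * Re \<zeta>)) * (2 * Re \<zeta> * Im (D \<zeta> 1))"
    unfolding inner[symmetric] by (rule det_adapted_basis)
  also have "\<dots> = (cmod z)\<^sup>2 * jacobian f \<zeta>"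
    using neg by (simp add: z jacobian_eq Re_divide_of_real Im_divide_of_real field_simps
        del: of_real_mult)
  finally show "det (matrix (to_coords \<circ> ?L \<circ> of_coords)) > 0"
    using neg z jacobian_pos[OF \<zeta>] by simp
qed

section \<open>Horizontal derivatives, Beltrami coefficient and quasiconformality\<close>

text \<open>Applied to functions of \<open>koranyi\<close>, Z acts as 2\<xi> times the Wirtinger
  derivative, and its conjugate likewise with the conjugate derivative. Since Z z = z, Z yields f_I
  (1 + 2\<xi> \<Phi>_\<zeta>), where the 1 cancels the -1/(2\<xi>) in \<Phi>_\<zeta>; the conjugate
  operator kills z.\<close>

lemma Z_op_F:
  assumes "p \<in> heis" and \<zeta>: "\<zeta> = koranyi p"
  shows "Z_op (fst \<circ> F) p = fst (F p) * of_real (Re \<zeta> / Re (f \<zeta>)) * wirtinger f \<zeta>"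
    and "Zbar_op (fst \<circ> F) p = fst (F p) * of_real (Re \<zeta> / Re (f \<zeta>)) * wirtinger_bar f \<zeta>"
proof -
  obtain z t where p: "p = (z, t)" by (cases p)
  define E where "E = exp (log_factor \<zeta>)"
  define X where "X = complex_of_real (Re \<zeta>)"
  define U where "U = complex_of_real (Re (f \<zeta>))"
  \<comment> \<open>\<open>Q\<close> and \<open>R\<close> are the derivatives of \<Phi> along
    \<open>1\<close> and \<open>\<i>\<close>.\<close>
  define Q where "Q = D \<zeta> 1 / (2 * U) - 1 / (2 * X)"
  define R where "R = D \<zeta> \<i> / (2 * U) - \<i> / (2 * X)"
  have \<zeta>_in: "\<zeta> \<in> left_half_plane"
    using koranyi_in_left_half_plane[OF assms(1)] by (simp add: \<zeta>)
  have nz: "X \<noteq> 0" "U \<noteq> 0"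
    using Re_neg[OF \<zeta>_in] Re_f_neg[OF \<zeta>_in] by (auto simp: X_def U_def)
  have z: "z * cnj z = - X" "complex_of_real ((cmod z)\<^sup>2) = - X"
    by (simp_all add: X_def \<zeta> p Re_koranyi complex_norm_square flip: of_real_power)
  have der: "frechet_derivative (fst \<circ> F) (at (z, t)) (w, s) =
      E * (w + z * (of_real (- 2 * (z \<bullet> w)) * Q + of_real s * R))" for w s
  proof -
    let ?v = "Complex (- 2 * (z \<bullet> w)) s"
    have v: "?v = of_real (- 2 * (z \<bullet> w)) + of_real s * \<i>"
      by (simp add: complex_eq_iff)
    have Dv: "D \<zeta> ?v = of_real (- 2 * (z \<bullet> w)) * D \<zeta> 1 + of_real s * D \<zeta> \<i>"
      by (subst D_decomp[OF \<zeta>_in]) simp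
    have "D \<zeta> ?v / (2 * U) - ?v / (2 * X) = of_real (- 2 * (z \<bullet> w)) * Q + of_real s * R"
      unfolding Dv unfolding v Q_def R_def
      by (simp add: add_divide_distrib diff_divide_distrib algebra_simps)
    then show ?thesis
      using assms(1) frechet_derivative_F[of z t \<zeta> _ w s, OF _ _ refl]
      by (simp add: p \<zeta> E_def U_def X_def frechet_derivative_fst_F)
  qed
  have z_decomp: "z = of_real (Re z) + \<i> * of_real (Im z)"
    "cnj z = of_real (Re z) - \<i> * of_real (Im z)"
    by (simp_all add: complex_eq_iff)
  have "partial_z (fst \<circ> F) p = E * (1 - z * cnj z * Q)"
    unfolding partial_z_def p der by (simp add: inner_complex_def z_decomp(2) field_simps)
  then have pz: "partial_z (fst \<circ> F) p = E * (1 + X * Q)"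
    by (simp add: z)
  have pzbar: "partial_zbar (fst \<circ> F) p = - E * z * z * Q"
  proof -
    have "partial_zbar (fst \<circ> F) p = - E * z * (of_real (Re z) + \<i> * of_real (Im z)) * Q"
      unfolding partial_zbar_def p der by (simp add: inner_complex_def field_simps)
    then show ?thesis
      by (simp only: z_decomp(1)[symmetric])
  qed
  have pt: "partial_t (fst \<circ> F) p = E * z * R"
    unfolding partial_t_def p der by simp
  have fst_F: "fst (F p) = z * E"
    using F_eq[OF assms(1)] by (simp add: p \<zeta> E_def)
  have Z: "Z_op (fst \<circ> F) p = z * E * (1 + X * Q - \<i> * X * R)"
    using pz pt unfolding p Z_op_def by (simp add: z(2) algebra_simps del: of_real_power)
  have "1 + X * Q - \<i> * X * R = X / U * wirtinger f \<zeta>"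
    unfolding wirtinger_def Q_def R_def using nz by (simp add: field_simps)
  then show "Z_op (fst \<circ> F) p = fst (F p) * of_real (Re \<zeta> / Re (f \<zeta>)) * wirtinger f \<zeta>"
    unfolding Z fst_F of_real_divide X_def[symmetric] U_def[symmetric] by (simp only: mult.assoc)
  have "Zbar_op (fst \<circ> F) p = - (E * z * (z * cnj z) * Q) + \<i> * X * E * z * R"
    using pzbar pt unfolding p Zbar_op_def by (simp add: z(2) algebra_simps del: of_real_power)
  then have Zbar: "Zbar_op (fst \<circ> F) p = z * E * (X * Q + \<i> * X * R)"
    unfolding z(1) by (simp add: algebra_simps del: comp_apply)
  have "X * Q + \<i> * X * R = X / U * wirtinger_bar f \<zeta>"
    unfolding wirtinger_bar_def Q_def R_def using nz by (simp add: field_simps)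
  then show "Zbar_op (fst \<circ> F) p = fst (F p) * of_real (Re \<zeta> / Re (f \<zeta>)) * wirtinger_bar f \<zeta>"
    unfolding Zbar fst_F of_real_divide X_def[symmetric] U_def[symmetric] by (simp only: mult.assoc)
qed

lemma op_contact_F: "op_contact_transformation F"
  unfolding op_contact_transformation_def
  using smooth_diffeo_F orientation_preserving_F contact_F
  by (auto intro!: exI[of _ "\<lambda>_. 1"])

text \<open>This factor, shared by both horizontal derivatives, cancels in the Beltrami quotient and
  preserves strict inequality of moduli.\<close>

lemma Z_op_factor_nonzero:
  "p \<in> heis \<Longrightarrow> fst (F p) * of_real (Re (koranyi p) / Re (f (koranyi p))) \<noteq> 0"
  using F_in[of p] Re_neg[OF koranyi_in_left_half_plane[of p]]
    Re_f_neg[OF koranyi_in_left_half_plane[of p]] by (cases "F p") auto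

lemma heis_beltrami_F: "p \<in> heis \<Longrightarrow> heis_beltrami F p = beltrami f (koranyi p)"
  unfolding heis_beltrami_def beltrami_def Z_op_F[OF _ refl]
  using Z_op_factor_nonzero by (rule mult_divide_mult_cancel_left)

lemma wirtinger_bar_less:
  "\<zeta> \<in> left_half_plane \<Longrightarrow> cmod (wirtinger_bar f \<zeta>) < cmod (wirtinger f \<zeta>)"
  using jacobian_pos[of \<zeta>] unfolding jacobian_def by (simp add: power2_less_imp_less)

lemma quasiconformal_F:
  assumes "quasiconformal_plane f"
  shows "quasiconformal_heis F"
proof -
  define k where "k = (SUP \<zeta>\<in>left_half_plane. cmod (beltrami f \<zeta>))"
  have "k < 1" and k: "\<And>\<zeta>. \<zeta> \<in> left_half_plane \<Longrightarrow> cmod (beltrami f \<zeta>) \<le> k"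
    using assms by (auto simp: quasiconformal_plane_def k_def intro: cSUP_upper)
  \<comment> \<open>The bound is the increasing function (1 + x)/(1 - x) at x = \<open>k\<close>; at
    x = |\<mu>| it is the distortion. Cross-multiplied, the estimate is just
    \<open>b \<le> k * a\<close>.\<close>
  have "cmod (Zbar_op (fst \<circ> F) p) < cmod (Z_op (fst \<circ> F) p) \<and>
      distortion F p \<le> (1 + k) / (1 - k)" if p: "p \<in> heis" for p
  proof -
    define a where "a = cmod (Z_op (fst \<circ> F) p)"
    define b where "b = cmod (Zbar_op (fst \<circ> F) p)"
    have ba: "b < a"
      using Z_op_factor_nonzero[OF p] wirtinger_bar_less[OF koranyi_in_left_half_plane[OF p]]
      unfolding a_def b_def Z_op_F[OF p refl] norm_mult by (intro mult_strict_left_mono) simp_all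
    moreover have "0 \<le> b"
      by (simp add: b_def)
    moreover have "b / a = cmod (beltrami f (koranyi p))"
      by (simp add: a_def b_def flip: heis_beltrami_F[OF p] heis_beltrami_def norm_divide)
    ultimately have "b \<le> k * a"
      using k[OF koranyi_in_left_half_plane[OF p]] by (metis le_less_trans pos_divide_le_eq)
    then have "(a + b) * (1 - k) \<le> (1 + k) * (a - b)"
      by (simp add: algebra_simps)
    then show ?thesis
      using ba \<open>k < 1\<close> by (simp add: distortion_def field_simps flip: a_def b_def)
  qed
  then show ?thesis
    using op_contact_F unfolding quasiconformal_heis_def K_quasiconformal_def by blast
qed

end

theorem theorem6p7:
  fixes f :: "complex \<Rightarrow> complex" and \<psi> :: "complex \<Rightarrow> real"
  assumes "smooth_diffeo left_half_plane left_half_plane f"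
    and "symplectic f"
    and "\<forall>\<zeta>\<in>left_half_plane. \<psi> differentiable (at \<zeta>)"
    and "\<forall>\<zeta>\<in>left_half_plane.
           wirtinger (\<lambda>x. of_real (\<psi> x)) \<zeta> =
             \<i> / (4 * of_real (Re \<zeta>)) +
             wirtinger (\<lambda>x. of_real (Im (f x))) \<zeta> / (2 * of_real (Re (f \<zeta>)))"
  shows "op_contact_transformation (circle_lift f \<psi>) \<and>
         circles_preserving (circle_lift f \<psi>) \<and>
         (quasiconformal_plane f \<longrightarrow>
            quasiconformal_heis (circle_lift f \<psi>) \<and>
            (\<forall>p\<in>heis. heis_beltrami (circle_lift f \<psi>) p = beltrami f (koranyi p)))"
proof -
  interpret symplectic_lift f \<psi>
    using assms by unfold_locales auto
  show ?thesis
    using op_contact_F circles_preserving_F quasiconformal_F heis_beltrami_F by blast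
qed

end
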